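(* For each $t\in\mathbb{R}$, the functional $I_{\overline{T}_1}:\overline{T}_1\to\mathbb{R}$, $I_{\overline{T}_1}(\phi)=\beta_{f_\phi}(t)$, is continuous on $\overline{T}_1$ (with the topology induced by the norm of $E_1$).
   Context: Let $\Delta=\{|z|<1\}$ and $\widehat{\mathbb{C}}=\mathbb{C}\cup\{\infty\}$. For a univalent function $f$ (injective holomorphic) in $\Delta$ and $t\in\mathbb{R}$, the integral means spectrum is $$\beta_f(t)=\limsup_{r\to1^-}\frac{\log\int_0^{2\pi}|f'(re^{i\theta})|^t\,d\theta}{|\log(1-r)|}.$$ $\mathcal{S}$ is the class of univalent $f$ in $\Delta$ with $f(0)=f'(0)-1=0$. $\mathcal{S}_q$ is the class of bounded $f\in\mathcal{S}$ that admit a quasiconformal extension to $\widehat{\mathbb{C}}$, and $\mathcal{S}_q^\infty$ is the class of $f\in\mathcal{S}_q$ that have a quasiconformal extension (still denoted $f$) to $\widehat{\mathbb{C}}$ with $f(\infty)=\infty$. $E_1$ is the Banach space of analytic functions $\phi$ in $\Delta$ with $\|\phi\|_{E_1}=\sup_{z\in\Delta}|\phi(z)|(1-|z|^2)<\infty$. For a locally univalent $f$, the Pre-Schwarzian derivative is $N_f=f''/f'$. Let $T_1=\mathbf{N}_q=\{N_f: f\in\mathcal{S}_q^\infty\}\subset E_1$ (a model of the universal Teichmüller space) and let $\overline{T}_1=\overline{\mathbf{N}}_q$ be its closure in $E_1$. For every $\phi\in\overline{T}_1$ there is a unique univalent $f_\phi\in\mathcal{S}$ with $N_{f_\phi}=\phi$,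 namely $f_\phi(z)=\int_0^z\exp\left(\int_0^\zeta\phi(w)\,dw\right)d\zeta$. *)

theory Defs
  imports "HOL-Complex_Analysis.Complex_Analysis"
begin

text \<open>Analytic functions in the unit disk are represented by functions on the plane that vanish
  off the disk, so that equality in the type is equality on the disk.\<close>

typedef E1 = "{\<phi> :: complex \<Rightarrow> complex. \<phi> holomorphic_on ball 0 1 \<and> (\<forall>z. z \<notin> ball 0 1 \<longrightarrow> \<phi> z = 0) \<and>
    bdd_above ((\<lambda>z. cmod (\<phi> z) * (1 - (cmod z)\<^sup>2)) ` ball 0 1)}"
  morphisms E1_fun Abs_E1
  by (rule exI[of _ "\<lambda>_. 0"]) (auto intro!: bdd_aboveI[of _ 0])

setup_lifting type_definition_E1

lemma E1_fun_holomorphic: "E1_fun \<phi> holomorphic_on ball 0 1"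
  by transfer auto

lemma E1_eqI: "(\<And>z. z \<in> ball 0 1 \<Longrightarrow> E1_fun \<phi> z = E1_fun \<psi> z) \<Longrightarrow> \<phi> = \<psi>"
  by transfer (metis (no_types, lifting) ext mem_Collect_eq)

lemma disk_weight_nonneg: "z \<in> ball 0 1 \<Longrightarrow> 0 \<le> 1 - (cmod z)\<^sup>2"
  by (simp add: power_le_one)

lemma disk_weight_pos: "z \<in> ball 0 1 \<Longrightarrow> 0 < 1 - (cmod z)\<^sup>2"
  by (simp add: power_less_one_iff)

lemma bdd_above_weighted_add:
  assumes "bdd_above ((\<lambda>z. cmod (f z) * (1 - (cmod z)\<^sup>2)) ` ball 0 1)"
    and "bdd_above ((\<lambda>z. cmod (g z) * (1 - (cmod z)\<^sup>2)) ` ball 0 1)"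
    and "\<And>z. z \<in> ball 0 1 \<Longrightarrow> cmod (h z) \<le> cmod (f z) + cmod (g z)"
  shows "bdd_above ((\<lambda>z. cmod (h z) * (1 - (cmod z)\<^sup>2)) ` ball 0 1)"
proof -
  obtain A B where A: "\<And>z. z \<in> ball 0 1 \<Longrightarrow> cmod (f z) * (1 - (cmod z)\<^sup>2) \<le> A"
    and B: "\<And>z. z \<in> ball 0 1 \<Longrightarrow> cmod (g z) * (1 - (cmod z)\<^sup>2) \<le> B"
    using assms(1,2) unfolding bdd_above_def ball_simps by blast
  show ?thesis
  proof (rule bdd_aboveI2)
    fix z :: complex assume z: "z \<in> ball 0 1"
    have "cmod (h z) * (1 - (cmod z)\<^sup>2) \<le> (cmod (f z) + cmod (g z)) * (1 - (cmod z)\<^sup>2)"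
      using assms(3)[OF z] disk_weight_nonneg[OF z] by (rule mult_right_mono)
    also have "\<dots> \<le> A + B"
      using A[OF z] B[OF z] by (simp add: distrib_right)
    finally show "cmod (h z) * (1 - (cmod z)\<^sup>2) \<le> A + B" .
  qed
qed

lemma bdd_above_weighted_scale:
  assumes "bdd_above ((\<lambda>z. cmod (f z) * (1 - (cmod z)\<^sup>2)) ` ball 0 1)"
  shows "bdd_above ((\<lambda>z. cmod (c *\<^sub>R f z) * (1 - (cmod z)\<^sup>2)) ` ball 0 1)"
proof -
  obtain A where A: "\<And>z. z \<in> ball 0 1 \<Longrightarrow> cmod (f z) * (1 - (cmod z)\<^sup>2) \<le> A"
    using assms unfolding bdd_above_def ball_simps by blast
  show ?thesis
  proof (rule bdd_aboveI2)
    fix z :: complex assume z: "z \<in> ball 0 1"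
    show "cmod (c *\<^sub>R f z) * (1 - (cmod z)\<^sup>2) \<le> \<bar>c\<bar> * A"
      using mult_left_mono[OF A[OF z], of "\<bar>c\<bar>"] by (simp add: mult.assoc)
  qed
qed

instantiation E1 :: real_normed_vector
begin

lift_definition zero_E1 :: E1 is "\<lambda>_. 0"
  by (auto intro!: bdd_aboveI[of _ 0])

lift_definition plus_E1 :: "E1 \<Rightarrow> E1 \<Rightarrow> E1" is "\<lambda>f g z. f z + g z"
  by (auto intro!: holomorphic_intros intro: bdd_above_weighted_add[OF _ _ norm_triangle_ineq])

lift_definition minus_E1 :: "E1 \<Rightarrow> E1 \<Rightarrow> E1" is "\<lambda>f g z. f z - g z"
  by (auto intro!: holomorphic_intros intro: bdd_above_weighted_add[OF _ _ norm_triangle_ineq4])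

lift_definition uminus_E1 :: "E1 \<Rightarrow> E1" is "\<lambda>f z. - f z"
  by (auto intro!: holomorphic_intros)

lift_definition scaleR_E1 :: "real \<Rightarrow> E1 \<Rightarrow> E1" is "\<lambda>c f z. c *\<^sub>R f z"
proof safe
  fix c :: real and f :: "complex \<Rightarrow> complex"
  assume "f holomorphic_on ball 0 1"
  then show "(\<lambda>z. c *\<^sub>R f z) holomorphic_on ball 0 1"
    unfolding scaleR_conv_of_real by (intro holomorphic_intros)
next
  fix c :: real and f :: "complex \<Rightarrow> complex"
  assume "bdd_above ((\<lambda>z. cmod (f z) * (1 - (cmod z)\<^sup>2)) ` ball 0 1)"
  then show "bdd_above ((\<lambda>z. cmod (c *\<^sub>R f z) * (1 - (cmod z)\<^sup>2)) ` ball 0 1)"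
    by (rule bdd_above_weighted_scale)
qed auto

lift_definition norm_E1 :: "E1 \<Rightarrow> real"
  is "\<lambda>f. SUP z\<in>ball 0 1. cmod (f z) * (1 - (cmod z)\<^sup>2)" .

definition dist_E1 :: "E1 \<Rightarrow> E1 \<Rightarrow> real"
  where "dist_E1 \<phi> \<psi> = norm (\<phi> - \<psi>)"

definition sgn_E1 :: "E1 \<Rightarrow> E1"
  where "sgn_E1 \<phi> = inverse (norm \<phi>) *\<^sub>R \<phi>"

definition uniformity_E1 :: "(E1 \<times> E1) filter"
  where "uniformity_E1 = (INF e\<in>{0<..}. principal {(x, y). dist x y < e})"

definition open_E1 :: "E1 set \<Rightarrow> bool"
  where "open_E1 S \<longleftrightarrow> (\<forall>x\<in>S. \<forall>\<^sub>F (x', y) in uniformity. x' = x \<longrightarrow> y \<in> S)"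

lemma E1_norm_bound:
  assumes "z \<in> ball 0 1"
  shows "cmod (E1_fun \<phi> z) * (1 - (cmod z)\<^sup>2) \<le> norm \<phi>"
  using assms by transfer (auto intro!: cSUP_upper)

lemma E1_norm_le:
  assumes "\<And>z. z \<in> ball 0 1 \<Longrightarrow> cmod (E1_fun \<phi> z) * (1 - (cmod z)\<^sup>2) \<le> B"
  shows "norm \<phi> \<le> B"
  using assms by transfer (auto intro!: cSUP_least)

instance
proof
  fix x y z :: E1 and a b :: real
  show "x + y + z = x + (y + z)" by transfer (simp add: add.assoc)
  show "x + y = y + x" by transfer (simp add: add.commute)
  show "0 + x = x" by transfer simp
  show "- x + x = 0" by transfer simp
  show "x - y = x + - y" by transfer simp
  show "a *\<^sub>R (x + y) = a *\<^sub>R x + a *\<^sub>R y" by transfer (simp add: scaleR_add_right)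
  show "(a + b) *\<^sub>R x = a *\<^sub>R x + b *\<^sub>R x" by transfer (simp add: scaleR_add_left)
  show "a *\<^sub>R b *\<^sub>R x = (a * b) *\<^sub>R x" by transfer simp
  show "1 *\<^sub>R x = x" by transfer simp
  show "norm x = 0 \<longleftrightarrow> x = 0"
  proof
    assume n: "norm x = 0"
    show "x = 0"
    proof (rule E1_eqI)
      fix z :: complex assume z: "z \<in> ball 0 1"
      have "cmod (E1_fun x z) * (1 - (cmod z)\<^sup>2) \<le> 0"
        using E1_norm_bound[OF z, of x] n by simp
      then have "E1_fun x z = 0"
        using disk_weight_pos[OF z] by (simp add: mult_le_0_iff)
      then show "E1_fun x z = E1_fun 0 z"
        by (simp add: zero_E1.rep_eq)
    qed
  qed (simp add: norm_E1.rep_eq zero_E1.rep_eq)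
  show "norm (x + y) \<le> norm x + norm y"
  proof (rule E1_norm_le)
    fix z :: complex assume z: "z \<in> ball 0 1"
    have "cmod (E1_fun (x + y) z) * (1 - (cmod z)\<^sup>2)
        \<le> (cmod (E1_fun x z) + cmod (E1_fun y z)) * (1 - (cmod z)\<^sup>2)"
      by (intro mult_right_mono disk_weight_nonneg z)
        (simp add: plus_E1.rep_eq norm_triangle_ineq)
    also have "\<dots> \<le> norm x + norm y"
      using E1_norm_bound[OF z, of x] E1_norm_bound[OF z, of y] by (simp add: distrib_right)
    finally show "cmod (E1_fun (x + y) z) * (1 - (cmod z)\<^sup>2) \<le> norm x + norm y" .
  qed
  have le: "norm (c *\<^sub>R w) \<le> \<bar>c\<bar> * norm w" for c and w :: E1
  proof (rule E1_norm_le)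
    fix z :: complex assume z: "z \<in> ball 0 1"
    show "cmod (E1_fun (c *\<^sub>R w) z) * (1 - (cmod z)\<^sup>2) \<le> \<bar>c\<bar> * norm w"
      using mult_left_mono[OF E1_norm_bound[OF z, of w], of "\<bar>c\<bar>"]
      by (simp add: scaleR_E1.rep_eq mult.assoc)
  qed
  show "norm (a *\<^sub>R x) = \<bar>a\<bar> * norm x"
  proof (cases "a = 0")
    case True
    then have "a *\<^sub>R x = 0" by transfer simp
    then show ?thesis using True by (simp add: norm_E1.rep_eq zero_E1.rep_eq)
  next
    case False
    have "x = inverse a *\<^sub>R (a *\<^sub>R x)" using False by transfer simp
    then have "norm x \<le> \<bar>inverse a\<bar> * norm (a *\<^sub>R x)" using le by metis
    then have "\<bar>a\<bar> * norm x \<le> norm (a *\<^sub>R x)" using False by (simp add: field_simps)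
    then show ?thesis using le[of a x] by simp
  qed
  show "dist x y = norm (x - y)" by (rule dist_E1_def)
  show "sgn x = inverse (norm x) *\<^sub>R x" by (rule sgn_E1_def)
qed (rule uniformity_E1_def open_E1_def)+

end

instance E1 :: banach
proof
  fix X :: "nat \<Rightarrow> E1"
  assume X: "Cauchy X"
  define w where "w z = 1 - (cmod z)\<^sup>2" for z :: complex
  have diff: "cmod (E1_fun (X m) z - E1_fun (X n) z) * w z \<le> norm (X m - X n)"
    if "z \<in> ball 0 1" for m n z
    using E1_norm_bound[OF that, of "X m - X n"] by (simp add: minus_E1.rep_eq w_def)
  have "\<exists>l. (\<lambda>n. E1_fun (X n) z) \<longlonglongrightarrow> l" if z: "z \<in> ball 0 1" for z
  proof -
    have w: "w z > 0" using disk_weight_pos[OF z] by (simp add: w_def)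
    have "Cauchy (\<lambda>n. E1_fun (X n) z)"
    proof (rule metric_CauchyI)
      fix e :: real assume "e > 0"
      then obtain M where M: "\<And>m n. m \<ge> M \<Longrightarrow> n \<ge> M \<Longrightarrow> dist (X m) (X n) < e * w z"
        using metric_CauchyD[OF X, of "e * w z"] w by auto
      have "dist (E1_fun (X m) z) (E1_fun (X n) z) < e" if "m \<ge> M" "n \<ge> M" for m n
      proof -
        have "cmod (E1_fun (X m) z - E1_fun (X n) z) * w z < e * w z"
          using diff[OF z, of m n] M[OF that] by (simp add: dist_norm)
        then show ?thesis using w by (simp add: dist_norm)
      qed
      then show "\<exists>M. \<forall>m\<ge>M. \<forall>n\<ge>M. dist (E1_fun (X m) z) (E1_fun (X n) z) < e" by blast
    qed
    then show ?thesis using Cauchy_convergent_iff convergent_def by blast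
  qed
  then obtain l0 where l0: "\<And>z. z \<in> ball 0 1 \<Longrightarrow> (\<lambda>n. E1_fun (X n) z) \<longlonglongrightarrow> l0 z"
    by metis
  define l where "l z = (if z \<in> ball 0 1 then l0 z else 0)" for z
  have l: "(\<lambda>n. E1_fun (X n) z) \<longlonglongrightarrow> l z" if "z \<in> ball 0 1" for z
    using l0[OF that] that by (simp add: l_def)
  have close: "\<exists>M. \<forall>n\<ge>M. \<forall>z\<in>ball 0 1. cmod (E1_fun (X n) z - l z) * w z \<le> e" if "e > 0" for e
  proof -
    obtain M where M: "\<And>m n. m \<ge> M \<Longrightarrow> n \<ge> M \<Longrightarrow> dist (X m) (X n) < e"
      using metric_CauchyD[OF X \<open>e > 0\<close>] by blast
    have "cmod (E1_fun (X n) z - l z) * w z \<le> e" if "n \<ge> M" and z: "z \<in> ball 0 1" for n z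
    proof (rule tendsto_upperbound)
      show "(\<lambda>m. cmod (E1_fun (X n) z - E1_fun (X m) z) * w z)
          \<longlonglongrightarrow> cmod (E1_fun (X n) z - l z) * w z"
        by (intro tendsto_intros l z)
      show "\<forall>\<^sub>F m in sequentially. cmod (E1_fun (X n) z - E1_fun (X m) z) * w z \<le> e"
        using eventually_ge_at_top[of M]
      proof eventually_elim
        case (elim m)
        then show ?case using diff[OF z, of n m] M[OF \<open>n \<ge> M\<close> elim] by (simp add: dist_norm)
      qed
    qed simp
    then show ?thesis by blast
  qed
  have "l holomorphic_on ball 0 1"
  proof (rule holomorphic_uniform_sequence)
    show "E1_fun (X n) holomorphic_on ball 0 1" for n by (rule E1_fun_holomorphic)
    fix x :: complex assume "x \<in> ball 0 1"
    then obtain d where d: "d > 0" "cball x d \<subseteq> ball 0 1"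
      using open_contains_cball by blast
    have "compact (cball x d)" by simp
    moreover have "continuous_on (cball x d) w" unfolding w_def by (intro continuous_intros)
    ultimately obtain z0 where z0: "z0 \<in> cball x d" "\<And>z. z \<in> cball x d \<Longrightarrow> w z0 \<le> w z"
      using continuous_attains_inf[of "cball x d" w] d(1) by auto
    have w0: "w z0 > 0" using disk_weight_pos z0(1) d(2) by (auto simp: w_def)
    have "uniform_limit (cball x d) (\<lambda>n. E1_fun (X n)) l sequentially"
    proof (rule uniform_limitI)
      fix e :: real assume "e > 0"
      then obtain M where M: "\<And>n z. n \<ge> M \<Longrightarrow> z \<in> ball 0 1
          \<Longrightarrow> cmod (E1_fun (X n) z - l z) * w z \<le> e / 2 * w z0"
        using close[of "e / 2 * w z0"] w0 by (meson half_gt_zero mult_pos_pos)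
      have "dist (E1_fun (X n) z) (l z) < e" if "n \<ge> M" "z \<in> cball x d" for n z
      proof -
        have "cmod (E1_fun (X n) z - l z) * w z0 \<le> cmod (E1_fun (X n) z - l z) * w z"
          using z0(2)[OF that(2)] by (intro mult_left_mono) auto
        also have "\<dots> \<le> e / 2 * w z0" using M that d(2) by blast
        finally have "cmod (E1_fun (X n) z - l z) \<le> e / 2" using w0 by simp
        then show ?thesis using \<open>e > 0\<close> by (simp add: dist_norm)
      qed
      then show "\<forall>\<^sub>F n in sequentially. \<forall>z\<in>cball x d. dist (E1_fun (X n) z) (l z) < e"
        unfolding eventually_sequentially by blast
    qed
    then show "\<exists>d>0. cball x d \<subseteq> ball 0 1
        \<and> uniform_limit (cball x d) (\<lambda>n. E1_fun (X n)) l sequentially"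
      using d by blast
  qed simp
  moreover have "bdd_above ((\<lambda>z. cmod (l z) * (1 - (cmod z)\<^sup>2)) ` ball 0 1)"
  proof -
    obtain n where n: "\<And>z. z \<in> ball 0 1 \<Longrightarrow> cmod (E1_fun (X n) z - l z) * w z \<le> 1"
      using close[of 1] zero_less_one by (meson order_refl)
    show ?thesis
    proof (rule bdd_above_weighted_add)
      show "bdd_above ((\<lambda>z. cmod (E1_fun (X n) z) * (1 - (cmod z)\<^sup>2)) ` ball 0 1)"
        by (rule bdd_aboveI2[of _ _ "norm (X n)"]) (rule E1_norm_bound)
      show "bdd_above ((\<lambda>z. cmod (E1_fun (X n) z - l z) * (1 - (cmod z)\<^sup>2)) ` ball 0 1)"
        by (rule bdd_aboveI2[of _ _ 1]) (use n in \<open>simp add: w_def\<close>)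
      show "cmod (l z) \<le> cmod (E1_fun (X n) z) + cmod (E1_fun (X n) z - l z)" for z
        using norm_triangle_ineq4[of "E1_fun (X n) z" "E1_fun (X n) z - l z"] by simp
    qed
  qed
  ultimately have L: "E1_fun (Abs_E1 l) = l"
    by (intro Abs_E1_inverse) (auto simp: l_def)
  have "X \<longlonglongrightarrow> Abs_E1 l"
  proof (rule metric_LIMSEQ_I)
    fix e :: real assume "e > 0"
    then obtain M where M: "\<And>n z. n \<ge> M \<Longrightarrow> z \<in> ball 0 1
        \<Longrightarrow> cmod (E1_fun (X n) z - l z) * w z \<le> e / 2"
      using close[of "e / 2"] by (meson half_gt_zero)
    have "norm (X n - Abs_E1 l) \<le> e / 2" if "n \<ge> M" for n
      by (rule E1_norm_le) (use M[OF that] in \<open>simp add: minus_E1.rep_eq L w_def\<close>)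
    then show "\<exists>M. \<forall>n\<ge>M. dist (X n) (Abs_E1 l) < e"
      using \<open>e > 0\<close> by (intro exI[of _ M]) (force simp: dist_norm)
  qed
  then show "convergent X" by (auto simp: convergent_def)
qed

definition abs_cont_on_interval :: "real \<Rightarrow> real \<Rightarrow> (real \<Rightarrow> complex) \<Rightarrow> bool" where
  "abs_cont_on_interval a b g \<longleftrightarrow>
    (\<forall>\<epsilon>>0. \<exists>\<delta>>0. \<forall>(n::nat) u v.
      (\<forall>i<n. a \<le> u i \<and> u i \<le> v i \<and> v i \<le> b) \<and>
      (\<forall>i<n. \<forall>j<n. i \<noteq> j \<longrightarrow> {u i<..<v i} \<inter> {u j<..<v j} = {}) \<and>
      (\<Sum>i<n. v i - u i) < \<delta>
      \<longrightarrow> (\<Sum>i<n. cmod (g (v i) - g (u i))) < \<epsilon>)"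

definition ACL_on :: "complex set \<Rightarrow> (complex \<Rightarrow> complex) \<Rightarrow> bool" where
  "ACL_on U F \<longleftrightarrow>
    (\<forall>a b. cbox a b \<subseteq> U \<longrightarrow>
      (AE y in lborel. y \<in> {Im a..Im b} \<longrightarrow>
        abs_cont_on_interval (Re a) (Re b) (\<lambda>x. F (Complex x y))) \<and>
      (AE x in lborel. x \<in> {Re a..Re b} \<longrightarrow>
        abs_cont_on_interval (Im a) (Im b) (\<lambda>y. F (Complex x y))))"

text \<open>The analytic definition of quasiconformality in an open subset of the plane.  With the
  partial derivatives \<open>p = F_x\<close> and \<open>q = F_y\<close> one has \<open>F_z = (p - \<i> q) / 2\<close> and
  \<open>F_zbar = (p + \<i> q) / 2\<close>, so the last clause is \<open>|F_zbar| \<le> k |F_z|\<close> almost everywhere.\<close>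

definition qc_on :: "real \<Rightarrow> complex set \<Rightarrow> (complex \<Rightarrow> complex) \<Rightarrow> bool" where
  "qc_on k U F \<longleftrightarrow>
    (\<exists>G. homeomorphism U (F ` U) F G) \<and> ACL_on U F \<and>
    (AE z in lborel. z \<in> U \<longrightarrow>
      (\<exists>p q. ((\<lambda>s::real. F (z + of_real s)) has_vector_derivative p) (at 0) \<and>
             ((\<lambda>s::real. F (z + \<i> * of_real s)) has_vector_derivative q) (at 0) \<and>
             cmod (p + \<i> * q) \<le> k * cmod (p - \<i> * q)))"

text \<open>The Riemann sphere is the one-point compactification of the plane, with \<open>None\<close> as the point
  at infinity.\<close>

abbreviation riemann_sphere :: "complex option topology" where
  "riemann_sphere \<equiv> Alexandroff_compactification euclidean"

definition sphere_inversion :: "complex option \<Rightarrow> complex option" where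
  "sphere_inversion p =
    (case p of None \<Rightarrow> Some 0 | Some z \<Rightarrow> if z = 0 then None else Some (1 / z))"

text \<open>The maps \<open>id\<close> and \<open>sphere_inversion\<close> exchange the two standard charts of the sphere; a
  homeomorphism of the sphere is quasiconformal if all four of its coordinate representations are,
  each on the open set of those finite coordinates that it sends to finite coordinates.\<close>

definition qc_sphere :: "(complex option \<Rightarrow> complex option) \<Rightarrow> bool" where
  "qc_sphere F \<longleftrightarrow>
    homeomorphic_map riemann_sphere riemann_sphere F \<and>
    (\<exists>k. 0 \<le> k \<and> k < 1 \<and>
      (\<forall>A\<in>{id, sphere_inversion}. \<forall>B\<in>{id, sphere_inversion}.
        qc_on k {z. A (F (B (Some z))) \<noteq> None} (\<lambda>z. the (A (F (B (Some z)))))))"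

definition qc_extension :: "(complex \<Rightarrow> complex) \<Rightarrow> (complex option \<Rightarrow> complex option) \<Rightarrow> bool" where
  "qc_extension f F \<longleftrightarrow> qc_sphere F \<and> (\<forall>z\<in>ball 0 1. F (Some z) = Some (f z))"

definition class_S :: "(complex \<Rightarrow> complex) set" where
  "class_S = {f. f holomorphic_on ball 0 1 \<and> inj_on f (ball 0 1) \<and> f 0 = 0 \<and> deriv f 0 = 1}"

definition class_S_q :: "(complex \<Rightarrow> complex) set" where
  "class_S_q = {f \<in> class_S. bounded (f ` ball 0 1) \<and> (\<exists>F. qc_extension f F)}"

definition class_S_q_inf :: "(complex \<Rightarrow> complex) set" where
  "class_S_q_inf = {f \<in> class_S_q. \<exists>F. qc_extension f F \<and> F None = None}"

definition pre_Schwarzian :: "(complex \<Rightarrow> complex) \<Rightarrow> complex \<Rightarrow> complex" where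
  "pre_Schwarzian f z = deriv (deriv f) z / deriv f z"

text \<open>By the classical estimate \<open>(1 - |z|^2) |f''(z) / f'(z)| \<le> 6\<close> for univalent \<open>f\<close>, every
  \<open>f \<in> class_S_q_inf\<close> contributes an element of \<open>E1\<close>.\<close>

definition T1 :: "E1 set" where
  "T1 = {\<phi>. \<exists>f\<in>class_S_q_inf. \<forall>z\<in>ball 0 1. E1_fun \<phi> z = pre_Schwarzian f z}"

definition f_of :: "E1 \<Rightarrow> complex \<Rightarrow> complex" where
  "f_of \<phi> z = contour_integral (linepath 0 z)
     (\<lambda>\<zeta>. exp (contour_integral (linepath 0 \<zeta>) (E1_fun \<phi>)))"

definition integral_means_spectrum :: "(complex \<Rightarrow> complex) \<Rightarrow> real \<Rightarrow> ereal" where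
  "integral_means_spectrum f t =
    Limsup (at_left 1) (\<lambda>r. ereal
      (ln (integral {0..2*pi} (\<lambda>\<theta>. cmod (deriv f (of_real r * exp (\<i> * of_real \<theta>))) powr t))
        / \<bar>ln (1 - r)\<bar>))"

text \<open>The integral formula does produce a normalized function whose pre-Schwarzian derivative is
  the given element of \<open>E1\<close>.\<close>

lemma disk_primitive:
  assumes "g holomorphic_on ball 0 1" and "z \<in> ball 0 1"
  shows "((\<lambda>z. contour_integral (linepath 0 z) g) has_field_derivative g z) (at z)"
proof (rule triangle_contour_integrals_starlike_primitive[OF _ _ open_ball])
  show "continuous_on (ball 0 1) g"
    using assms(1) by (rule holomorphic_on_imp_continuous_on)
  show "closed_segment 0 y \<subseteq> ball 0 1" if "y \<in> ball 0 1" for y :: complex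
    using that by (intro closed_segment_subset) auto
  fix b c :: complex
  assume "closed_segment b c \<subseteq> ball 0 1"
  then have "{0, b, c} \<subseteq> ball 0 1"
    using ends_in_segment by (fastforce simp del: mem_ball)
  then have "convex hull {0, b, c} \<subseteq> ball 0 1"
    by (rule hull_minimal) simp
  then show "contour_integral (linepath 0 b) g + contour_integral (linepath b c) g
      + contour_integral (linepath c 0) g = 0"
    using Cauchy_theorem_triangle[of g 0 b c] assms(1) holomorphic_on_subset
      has_chain_integral_chain_integral3 by blast
qed (use assms(2) in auto)

lemma deriv_f_of:
  assumes "z \<in> ball 0 1"
  shows "(f_of \<phi> has_field_derivative exp (contour_integral (linepath 0 z) (E1_fun \<phi>))) (at z)"
proof -
  have "(\<lambda>\<zeta>. contour_integral (linepath 0 \<zeta>) (E1_fun \<phi>)) holomorphic_on ball 0 1"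
    using disk_primitive[OF E1_fun_holomorphic, of _ \<phi>] by (subst holomorphic_on_open) blast+
  then have "(\<lambda>\<zeta>. exp (contour_integral (linepath 0 \<zeta>) (E1_fun \<phi>))) holomorphic_on ball 0 1"
    by (intro holomorphic_intros)
  from disk_primitive[OF this assms] show ?thesis
    by (simp add: f_of_def[abs_def])
qed

lemma f_of_properties:
  shows "f_of \<phi> holomorphic_on ball 0 1" and "f_of \<phi> 0 = 0" and "deriv (f_of \<phi>) 0 = 1"
    and "\<And>z. z \<in> ball 0 1 \<Longrightarrow> pre_Schwarzian (f_of \<phi>) z = E1_fun \<phi> z"
proof -
  show "f_of \<phi> holomorphic_on ball 0 1"
    using deriv_f_of[of _ \<phi>] by (subst holomorphic_on_open) blast+
  show "f_of \<phi> 0 = 0" by (simp add: f_of_def)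
  show "deriv (f_of \<phi>) 0 = 1"
    using DERIV_imp_deriv[OF deriv_f_of[of 0 \<phi>]] by simp
  fix z :: complex assume z: "z \<in> ball 0 1"
  let ?h = "\<lambda>\<zeta>. exp (contour_integral (linepath 0 \<zeta>) (E1_fun \<phi>))"
  have "(?h has_field_derivative ?h z * E1_fun \<phi> z) (at z)"
    using disk_primitive[OF E1_fun_holomorphic z] by (auto intro!: derivative_eq_intros)
  moreover have "(deriv (f_of \<phi>) has_field_derivative D) (at z)"
    if "(?h has_field_derivative D) (at z)" for D
    using that open_ball z
  proof (rule has_field_derivative_transform_within_open)
    show "?h x = deriv (f_of \<phi>) x" if "x \<in> ball 0 1" for x
      using DERIV_imp_deriv[OF deriv_f_of[OF that, of \<phi>]] by simp
  qed
  ultimately have "deriv (deriv (f_of \<phi>)) z = ?h z * E1_fun \<phi> z"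
    by (blast intro: DERIV_imp_deriv)
  then show "pre_Schwarzian (f_of \<phi>) z = E1_fun \<phi> z"
    using DERIV_imp_deriv[OF deriv_f_of[OF z, of \<phi>]] by (simp add: pre_Schwarzian_def)
qed

end

theory Submission
  imports Defs
begin

text \<open>Integrating \<open>|\<phi> - \<psi>| \<le> \<parallel>\<phi> - \<psi>\<parallel> / (1 - |z|)\<close> along a radius shows that \<open>|f_\<phi>' / f_\<psi>'|\<close> is at most
  \<open>(1 - |z|) powr (- \<parallel>\<phi> - \<psi>\<parallel>)\<close>.  Hence the logarithms of the integral means of order \<open>t\<close> differ by
  at most \<open>|t| \<parallel>\<phi> - \<psi>\<parallel> |log (1 - r)|\<close>, so the spectrum is \<open>|t|\<close>-Lipschitz in \<open>\<phi>\<close> on all of \<open>E1\<close>,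
  and comparison with \<open>\<psi> = 0\<close>, where \<open>f_\<psi>\<close> is the identity, gives finiteness.\<close>

text \<open>On the disk this is the branch of \<open>log (deriv (f_of \<phi>))\<close> that vanishes
  at 0. It is additive in \<phi>, so quotients of derivatives become differences.\<close>

definition primitive :: "E1 \<Rightarrow> complex \<Rightarrow> complex"
  where "primitive \<phi> z = contour_integral (linepath 0 z) (E1_fun \<phi>)"

definition integral_mean :: "E1 \<Rightarrow> real \<Rightarrow> real \<Rightarrow> real"
  where "integral_mean \<phi> t r =
    integral {0..2*pi} (\<lambda>\<theta>. cmod (deriv (f_of \<phi>) (of_real r * exp (\<i> * of_real \<theta>))) powr t)"

lemma contour_integrable_E1_fun:
  assumes "z \<in> ball 0 1"
  shows "E1_fun \<phi> contour_integrable_on linepath 0 z"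
proof (rule contour_integrable_continuous_linepath)
  have "closed_segment 0 z \<subseteq> ball 0 1"
    using assms by (intro closed_segment_subset) auto
  then show "continuous_on (closed_segment 0 z) (E1_fun \<phi>)"
    using E1_fun_holomorphic holomorphic_on_imp_continuous_on continuous_on_subset by blast
qed

lemma primitive_diff:
  "z \<in> ball 0 1 \<Longrightarrow> primitive (\<phi> - \<psi>) z = primitive \<phi> z - primitive \<psi> z"
  by (simp add: primitive_def minus_E1.rep_eq contour_integral_diff contour_integrable_E1_fun
      del: mem_ball)

lemma primitive_0: "primitive 0 z = 0"
  by (simp add: primitive_def zero_E1.rep_eq)

text \<open>With s = x * r this is the integral of 1 / (1 - s) over [0, r], written in the parameter
  of \<open>linepath 0 z\<close> for |z| = r.\<close>

lemma has_integral_radial_weight: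
  fixes r :: real
  assumes "0 \<le> r" "r < 1"
  shows "((\<lambda>x. r / (1 - x * r)) has_integral - ln (1 - r)) {0..1}"
proof -
  have pos: "1 - x * r > 0" if "x \<in> {0..1}" for x
    using that assms mult_left_le_one_le[of r x] by auto
  have "((\<lambda>x. r / (1 - x * r)) has_integral - ln (1 - 1 * r) - - ln (1 - 0 * r)) {0..1}"
  proof (rule fundamental_theorem_of_calculus)
    fix x :: real assume "x \<in> {0..1}"
    from pos[OF this] show "((\<lambda>x. - ln (1 - x * r)) has_vector_derivative r / (1 - x * r))
        (at x within {0..1})"
      unfolding has_real_derivative_iff_has_vector_derivative[symmetric]
      by (auto intro!: derivative_eq_intros)
  qed simp
  then show ?thesis by simp
qed

lemma norm_primitive_le:
  assumes z: "z \<in> ball 0 1"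
  shows "cmod (primitive \<phi> z) \<le> norm \<phi> * - ln (1 - cmod z)"
proof -
  have r: "0 \<le> cmod z" "cmod z < 1" using z by auto
  have "(E1_fun \<phi> has_contour_integral primitive \<phi> z) (linepath 0 z)"
    unfolding primitive_def
    by (intro has_contour_integral_integral contour_integrable_E1_fun z)
  then have *: "((\<lambda>x. E1_fun \<phi> (linepath 0 z x) * z) has_integral primitive \<phi> z) {0..1}"
    by (simp add: has_contour_integral_linepath)
  have I: "((\<lambda>x. norm \<phi> * (cmod z / (1 - x * cmod z))) has_integral norm \<phi> * - ln (1 - cmod z)) {0..1}"
    by (intro has_integral_mult_right has_integral_radial_weight r)
  have "cmod (integral {0..1} (\<lambda>x. E1_fun \<phi> (linepath 0 z x) * z))
      \<le> integral {0..1} (\<lambda>x. norm \<phi> * (cmod z / (1 - x * cmod z)))"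
  proof (rule integral_norm_bound_integral)
    fix x :: real assume x: "x \<in> {0..1}"
    let ?w = "linepath 0 z x"
    have w: "cmod ?w = x * cmod z" using x by (simp add: linepath_def)
    have le1: "x * cmod z \<le> cmod z" using x by (intro mult_left_le_one_le) auto
    \<comment> \<open>For s in [0, 1] one has s * s \<le> s, so 1 - s bounds the weight from below.
      Keeping 1 - s * s would halve the coefficient of the logarithm; the cruder weight has the
      simpler antiderivative.\<close>
    have "cmod (E1_fun \<phi> ?w) * (1 - x * cmod z) \<le> cmod (E1_fun \<phi> ?w) * (1 - (cmod ?w)\<^sup>2)"
      using x r le1 power_le_one[of "x * cmod z" 1] mult_left_le_one_le[of "x * cmod z" "x * cmod z"]
      by (intro mult_left_mono) (auto simp: w power2_eq_square)
    also have "\<dots> \<le> norm \<phi>"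
      using le1 r w by (intro E1_norm_bound) (simp only: mem_ball_0)
    finally have "cmod (E1_fun \<phi> ?w) \<le> norm \<phi> / (1 - x * cmod z)"
      using le1 r by (simp add: pos_le_divide_eq)
    from mult_right_mono[OF this r(1)]
    show "cmod (E1_fun \<phi> ?w * z) \<le> norm \<phi> * (cmod z / (1 - x * cmod z))"
      by (simp add: norm_mult)
  qed (use * I in \<open>auto simp: has_integral_iff\<close>)
  then show ?thesis using * I by (simp add: has_integral_iff)
qed

lemma norm_deriv_f_of:
  "z \<in> ball 0 1 \<Longrightarrow> cmod (deriv (f_of \<phi>) z) = exp (Re (primitive \<phi> z))"
  using DERIV_imp_deriv[OF deriv_f_of[of z \<phi>]] by (simp add: primitive_def)

text \<open>The power is exp (t * Re (\<open>primitive\<close> \<phi> z)), so the quotient of the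
  two sides is governed by the primitive of \<phi> - \<psi>. The factor |t| covers both signs of
  t.\<close>

lemma norm_deriv_f_of_powr_le:
  assumes z: "z \<in> ball 0 1"
  shows "cmod (deriv (f_of \<phi>) z) powr t
    \<le> exp (\<bar>t\<bar> * norm (\<phi> - \<psi>) * - ln (1 - cmod z)) * cmod (deriv (f_of \<psi>) z) powr t"
proof -
  have "t * Re (primitive \<phi> z) - t * Re (primitive \<psi> z) = t * Re (primitive (\<phi> - \<psi>) z)"
    using z by (simp add: primitive_diff algebra_simps del: mem_ball)
  also have "\<dots> \<le> \<bar>t\<bar> * cmod (primitive (\<phi> - \<psi>) z)"
    by (rule order_trans[OF abs_ge_self]) (simp add: abs_mult mult_left_mono abs_Re_le_cmod)
  also have "\<dots> \<le> \<bar>t\<bar> * (norm (\<phi> - \<psi>) * - ln (1 - cmod z))"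
    by (intro mult_left_mono norm_primitive_le z) simp
  finally show ?thesis
    by (simp add: norm_deriv_f_of[OF z] powr_def exp_add[symmetric] algebra_simps)
qed

lemma integrable_integral_mean:
  assumes "0 < r" "r < 1"
  shows "(\<lambda>\<theta>. cmod (deriv (f_of \<phi>) (of_real r * exp (\<i> * of_real \<theta>))) powr t)
    integrable_on {0..2*pi}"
proof (rule integrable_continuous_real)
  have circ: "of_real r * exp (\<i> * of_real \<theta>) \<in> ball 0 1" for \<theta>
    using assms by (simp add: norm_mult)
  have "deriv (f_of \<phi>) holomorphic_on ball 0 1"
    by (intro holomorphic_deriv f_of_properties open_ball)
  then have "continuous_on (ball 0 1) (deriv (f_of \<phi>))"
    by (rule holomorphic_on_imp_continuous_on)
  moreover have "continuous_on {0..2*pi} (\<lambda>\<theta>. of_real r * exp (\<i> * of_real \<theta>) :: complex)"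
    by (intro continuous_intros)
  ultimately have "continuous_on {0..2*pi} (\<lambda>\<theta>. deriv (f_of \<phi>) (of_real r * exp (\<i> * of_real \<theta>)))"
    by (rule continuous_on_compose2) (use circ in blast)
  \<comment> \<open>\<open>powr\<close> is discontinuous at base 0 when t \<le> 0, so the derivative
    must have no zeros on the circle.\<close>
  moreover have "deriv (f_of \<phi>) (of_real r * exp (\<i> * of_real \<theta>)) \<noteq> 0" for \<theta>
    using norm_deriv_f_of[OF circ, of \<phi> \<theta>] by force
  ultimately show "continuous_on {0..2*pi}
      (\<lambda>\<theta>. cmod (deriv (f_of \<phi>) (of_real r * exp (\<i> * of_real \<theta>))) powr t)"
    by (intro continuous_intros) auto
qed

text \<open>The pointwise factor depends on z only through |z|, so it is constant on the circle and
  leaves the integral.\<close>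

lemma integral_mean_le:
  assumes "0 < r" "r < 1"
  shows "integral_mean \<phi> t r \<le> exp (\<bar>t\<bar> * norm (\<phi> - \<psi>) * - ln (1 - r)) * integral_mean \<psi> t r"
  unfolding integral_mean_def integral_mult_right[symmetric]
proof (rule integral_le)
  fix \<theta> :: real
  have "cmod (of_real r * exp (\<i> * of_real \<theta>)) = r" using assms by (simp add: norm_mult)
  then show "cmod (deriv (f_of \<phi>) (of_real r * exp (\<i> * of_real \<theta>))) powr t
      \<le> exp (\<bar>t\<bar> * norm (\<phi> - \<psi>) * - ln (1 - r))
        * cmod (deriv (f_of \<psi>) (of_real r * exp (\<i> * of_real \<theta>))) powr t"
    using norm_deriv_f_of_powr_le[of "of_real r * exp (\<i> * of_real \<theta>)" \<phi> t \<psi>] assms by simp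
qed (use integrable_integral_mean[OF assms] in \<open>auto intro!: integrable_on_mult_right\<close>)

lemma integral_mean_0:
  assumes "0 < r" "r < 1"
  shows "integral_mean 0 t r = 2 * pi"
proof -
  have "cmod (deriv (f_of 0) (of_real r * exp (\<i> * of_real \<theta>))) = 1" for \<theta>
    using assms by (subst norm_deriv_f_of) (auto simp: norm_mult primitive_0)
  then show ?thesis by (simp add: integral_mean_def)
qed

text \<open>The comparison is read backwards: the mean 2 * pi of the zero element is at most a
  positive multiple of this one. Positivity makes the logarithms below meaningful.\<close>

lemma integral_mean_pos:
  assumes "0 < r" "r < 1"
  shows "integral_mean \<phi> t r > 0"
proof -
  have "0 < exp (\<bar>t\<bar> * norm (0 - \<phi>) * - ln (1 - r)) * integral_mean \<phi> t r"
    using integral_mean_le[OF assms, of 0 t \<phi>] integral_mean_0[OF assms, of t] pi_gt_zero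
    by linarith
  then show ?thesis by (simp add: zero_less_mult_iff)
qed

lemma ln_integral_mean_le:
  assumes "0 < r" "r < 1"
  shows "ln (integral_mean \<phi> t r) / \<bar>ln (1 - r)\<bar>
    \<le> ln (integral_mean \<psi> t r) / \<bar>ln (1 - r)\<bar> + \<bar>t\<bar> * norm (\<phi> - \<psi>)"
proof -
  have l: "ln (1 - r) < 0" using assms by simp
  have "ln (integral_mean \<phi> t r)
      \<le> ln (exp (\<bar>t\<bar> * norm (\<phi> - \<psi>) * - ln (1 - r)) * integral_mean \<psi> t r)"
    using integral_mean_le[OF assms] integral_mean_pos[OF assms] by (subst ln_le_cancel_iff) auto
  also have "\<dots> = \<bar>t\<bar> * norm (\<phi> - \<psi>) * - ln (1 - r) + ln (integral_mean \<psi> t r)"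
    using integral_mean_pos[OF assms, of \<psi> t] by (subst ln_mult_pos) auto
  \<comment> \<open>Since |ln (1 - r)| = - ln (1 - r), the division cancels the dependence of the
    error term on r.\<close>
  finally show ?thesis using l by (simp add: field_simps)
qed

lemma integral_means_spectrum_f_of:
  "integral_means_spectrum (f_of \<phi>) t =
    Limsup (at_left 1) (\<lambda>r. ereal (ln (integral_mean \<phi> t r) / \<bar>ln (1 - r)\<bar>))"
  by (simp add: integral_means_spectrum_def integral_mean_def)

lemma eventually_at_left_1: "\<forall>\<^sub>F r::real in at_left 1. 0 < r \<and> r < 1"
  by (rule eventually_at_leftI[of 0]) auto

text \<open>A finite constant passes through \<open>Limsup\<close>. The additive form stays
  meaningful in \<open>ereal\<close> before finiteness is known.\<close>

lemma integral_means_spectrum_le: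
  "integral_means_spectrum (f_of \<phi>) t
    \<le> integral_means_spectrum (f_of \<psi>) t + ereal (\<bar>t\<bar> * norm (\<phi> - \<psi>))"
proof -
  have "integral_means_spectrum (f_of \<phi>) t
      \<le> Limsup (at_left 1)
          (\<lambda>r. ereal (ln (integral_mean \<psi> t r) / \<bar>ln (1 - r)\<bar>) + ereal (\<bar>t\<bar> * norm (\<phi> - \<psi>)))"
    unfolding integral_means_spectrum_f_of using eventually_at_left_1
    by (intro Limsup_mono) (auto elim!: eventually_mono intro: ln_integral_mean_le)
  also have "\<dots> = integral_means_spectrum (f_of \<psi>) t + ereal (\<bar>t\<bar> * norm (\<phi> - \<psi>))"
    unfolding integral_means_spectrum_f_of by (rule Limsup_add_ereal_right) auto
  finally show ?thesis .
qed

lemma integral_means_spectrum_0: "integral_means_spectrum (f_of 0) t = 0"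
proof -
  have "((\<lambda>r::real. ln (2 * pi) / \<bar>ln (1 - r)\<bar>) \<longlongrightarrow> 0) (at_left 1)"
    by real_asymp
  then have "((\<lambda>r. ln (integral_mean 0 t r) / \<bar>ln (1 - r)\<bar>) \<longlongrightarrow> 0) (at_left 1)"
    by (rule Lim_transform_eventually)
      (use eventually_at_left_1 in \<open>auto elim!: eventually_mono simp: integral_mean_0\<close>)
  then have "((\<lambda>r. ereal (ln (integral_mean 0 t r) / \<bar>ln (1 - r)\<bar>)) \<longlongrightarrow> 0) (at_left 1)"
    by (simp add: zero_ereal_def)
  then show ?thesis
    unfolding integral_means_spectrum_f_of by (intro lim_imp_Limsup) auto
qed

text \<open>Comparison with 0 in both directions traps the value between - |t| * norm \<phi> and |t|
  * norm \<phi>.\<close>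

lemma integral_means_spectrum_finite: "\<bar>integral_means_spectrum (f_of \<phi>) t\<bar> \<noteq> \<infinity>"
  using integral_means_spectrum_le[of \<phi> t 0] integral_means_spectrum_le[of 0 t \<phi>]
  by (cases "integral_means_spectrum (f_of \<phi>) t") (auto simp: integral_means_spectrum_0)

lemma lipschitz_integral_means_spectrum:
  "\<bar>t\<bar>-lipschitz_on UNIV (\<lambda>\<phi>. real_of_ereal (integral_means_spectrum (f_of \<phi>) t))"
proof (rule lipschitz_onI)
  fix \<phi> \<psi> :: E1
  show "dist (real_of_ereal (integral_means_spectrum (f_of \<phi>) t))
      (real_of_ereal (integral_means_spectrum (f_of \<psi>) t)) \<le> \<bar>t\<bar> * dist \<phi> \<psi>"
    \<comment> \<open>\<open>real_of_ereal\<close> sends both infinities to 0, so finiteness is used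
      to discard those cases.\<close>
    using integral_means_spectrum_le[of \<phi> t \<psi>] integral_means_spectrum_le[of \<psi> t \<phi>]
      integral_means_spectrum_finite[of \<phi> t] integral_means_spectrum_finite[of \<psi> t]
    by (cases "integral_means_spectrum (f_of \<phi>) t"; cases "integral_means_spectrum (f_of \<psi>) t")
      (auto simp: dist_norm norm_minus_commute)
qed simp

theorem theorem1p16:
  fixes t :: real
  shows "(\<forall>\<phi>\<in>closure T1. \<bar>integral_means_spectrum (f_of \<phi>) t\<bar> \<noteq> \<infinity>) \<and>
    continuous_on (closure T1) (\<lambda>\<phi>. real_of_ereal (integral_means_spectrum (f_of \<phi>) t))"
  by (intro conjI ballI integral_means_spectrum_finite subset_UNIV
      continuous_on_subset[OF lipschitz_on_continuous_on[OF lipschitz_integral_means_spectrum]])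

end
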